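(* Let $n\ge 3$, $1\le t<n$, and let $c_1,c_2,\ldots,c_t\in[n]$ be distinct integers such that the sequence $(c_1,\ldots,c_t)$ avoids the pattern $123$. If $c_i<c_j$ for some $1\le i<j\le t$ and there exists $\alpha\in[n]$ with $\alpha>c_j$ and $\alpha\notin\{c_1,\ldots,c_t\}$ (for that same $j$), then $|S_{n,(c_1,\ldots,c_t)}(123)|=0$; otherwise, $$|S_{n,(c_1,\ldots,c_t)}(123)|=|S_{n-t+1,\min\{c_1,\ldots,c_t\}}(123)|=b_{n-t+1,\min\{c_1,\ldots,c_t\}},$$ where $b_{m,r}=\frac{m-r+1}{m+r-1}\binom{m+r-1}{m}$ for $1\le r\le m$.
   Context: $[n]=\{1,\ldots,n\}$ and $S_n$ is the set of permutations of $[n]$ written as sequences $(\tau(1),\ldots,\tau(n))$. A sequence of distinct integers $\tau=(\tau(1),\ldots,\tau(m))$ contains $\sigma\in S_k$ as a pattern if there are indices $1\le i_1<\cdots<i_k\le m$ such that for all $1\le a<b\le k$, $\tau(i_a)<\tau(i_b)$ if and only if $\sigma(a)<\sigma(b)$; otherwise $\tau$ avoids $\sigma$. $S_{n,(c_1,\ldots,c_t)}(\sigma)$ is the set of $\tau\in S_n$ with $(\tau(1),\ldots,\tau(t))=(c_1,\ldots,c_t)$ that avoid $\sigma$. For $1\le r\le m$, $S_{m,r}(\sigma)$ is the set of $\tau\in S_m$ with $\tau(1)=r$ that avoid $\sigma$. *)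

theory Defs
  imports Complex_Main "HOL-Combinatorics.Multiset_Permutations"
begin

text \<open>
  Sequences are lists, so positions are counted from 0: the entry \<open>\<tau>(i)\<close> is \<open>\<tau> ! (i - 1)\<close>.
  The function \<open>\<iota>\<close> selects the positions of an occurrence of the pattern \<open>\<sigma>\<close> in \<open>\<tau>\<close>.
\<close>

definition contains_pattern :: "'a::linorder list \<Rightarrow> nat list \<Rightarrow> bool" where
  "contains_pattern \<tau> \<sigma> \<longleftrightarrow>
     (\<exists>\<iota>. strict_mono_on {..<length \<sigma>} \<iota> \<and>
          (\<forall>a<length \<sigma>. \<iota> a < length \<tau>) \<and>
          (\<forall>a b. a < b \<and> b < length \<sigma> \<longrightarrow> (\<tau> ! \<iota> a < \<tau> ! \<iota> b \<longleftrightarrow> \<sigma> ! a < \<sigma> ! b)))"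

definition avoids :: "'a::linorder list \<Rightarrow> nat list \<Rightarrow> bool" where
  "avoids \<tau> \<sigma> \<longleftrightarrow> \<not> contains_pattern \<tau> \<sigma>"

definition perms :: "nat \<Rightarrow> nat list set" where
  "perms n = permutations_of_set {1..n}"

definition perms_prefix_avoiding :: "nat \<Rightarrow> nat list \<Rightarrow> nat list \<Rightarrow> nat list set" where
  "perms_prefix_avoiding n c \<sigma> = {\<tau> \<in> perms n. take (length c) \<tau> = c \<and> avoids \<tau> \<sigma>}"

text \<open>Meaningful for \<open>1 \<le> r \<le> m\<close> only, so that \<open>\<tau>\<close> is nonempty.\<close>

definition perms_first_avoiding :: "nat \<Rightarrow> nat \<Rightarrow> nat list \<Rightarrow> nat list set" where
  "perms_first_avoiding m r \<sigma> = {\<tau> \<in> perms m. \<tau> ! 0 = r \<and> avoids \<tau> \<sigma>}"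

definition ballot :: "nat \<Rightarrow> nat \<Rightarrow> real" where
  "ballot m r = (real m - real r + 1) / (real m + real r - 1) * real ((m + r - 1) choose m)"

end

theory Submission
  imports Defs
begin

text \<open>
  Appending \<open>w\<close> to \<open>c\<close> creates a new occurrence of 123 only through an ascent of \<open>c\<close> below an
  entry of \<open>w\<close>, or through an ascent of \<open>w\<close> above an entry of \<open>c\<close>; for the latter only \<open>min c\<close>
  matters.  All entries of \<open>[n]\<close> below \<open>r = min c\<close> are missing from \<open>c\<close>, so the possible \<open>w\<close> are
  counted by a function of the numbers \<open>k\<close> and \<open>l\<close> of missing entries below and above \<open>r\<close>.
  The first entry of \<open>w\<close> is either some \<open>x < r\<close>, which takes over the role of \<open>r\<close>, or the largest
  missing entry, which imposes no restriction; this yields the ballot recurrence.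
\<close>

section \<open>Ballot numbers: recurrence and closed form\<close>

text \<open>In the notation of the informal statement, \<open>ballot_num k l = b\<^bsub>k+l+1,k+1\<^esub>\<close>.\<close>

fun ballot_num :: "nat \<Rightarrow> nat \<Rightarrow> nat" where
  "ballot_num 0 l = 1"
| "ballot_num (Suc k) 0 = ballot_num k 1"
| "ballot_num (Suc k) (Suc l) = ballot_num k (l + 2) + ballot_num (Suc k) l"

text \<open>Iterating the third equation in its first summand, down to \<open>k = 0\<close>, keeps
  the sum of the two arguments at \<open>k + l\<close> and collects one term per step.\<close>

lemma ballot_num_Suc_eq_sum:
  "ballot_num k (Suc l) = (\<Sum>i<Suc k. ballot_num i (k + l - i))"
proof (induction k arbitrary: l)
  case 0
  then show ?case by simp
next
  case (Suc k)
  show ?case using Suc[of "Suc l"] by simp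
qed

text \<open>This is the recurrence by first entry. Summand \<open>i\<close> belongs to a first entry
  below r with \<open>i\<close> missing entries under it, the last term to the largest missing
  entry, if that lies above r. At \<open>k = l = 0\<close> the right side would be 0 instead of
  1.\<close>

lemma ballot_num_rec:
  assumes "0 < k + l"
  shows "ballot_num k l =
    (\<Sum>i<k. ballot_num i (k + l - 1 - i)) + (if l = 0 then 0 else ballot_num k (l - 1))"
proof (cases k)
  case 0
  then show ?thesis using assms by simp
next
  case (Suc k')
  then show ?thesis
    using ballot_num_Suc_eq_sum[of k' l] by (cases l) auto
qed

text \<open>This is the ballot formula with the factor \<open>2 * k + l + 1\<close> cancelled
  against the binomial coefficient, a shape that the recurrence preserves directly.\<close>

lemma ballot_num_eq_fact:
  "real (ballot_num k l) = real (l + 1) * fact (2 * k + l) / (fact k * fact (k + l + 1))"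
proof (induction k l rule: ballot_num.induct)
  case (1 l)
  then show ?case by simp
next
  case (2 k)
  define F :: real where "F = fact (2 * k + 1)"
  define P :: real where "P = fact k"
  define Q :: real where "Q = fact (k + 1 + 1)"
  define u where "u = real (Suc k)"
  have e: "2 * Suc k + 0 = Suc (2 * k + 1)" "Suc k + 0 + 1 = k + 1 + 1" by simp_all
  have u: "u > 0" "real (Suc (2 * k + 1)) = 2 * u" by (simp_all add: u_def)
  have "real (ballot_num (Suc k) 0) = 2 * F / (P * Q)"
    unfolding ballot_num.simps 2 F_def P_def Q_def by simp
  \<comment> \<open>One \<open>u\<close> is the new factor of \<open>fact (Suc k)\<close>; the
    other, doubled, is the new factor \<open>2 * k + 2\<close> of the numerator.\<close>
  also have "\<dots> = u * (2 * F) / (u * (P * Q))"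
    using u by simp
  also have "\<dots> = real (0 + 1) * fact (2 * Suc k + 0) / (fact (Suc k) * fact (Suc k + 0 + 1))"
    unfolding e fact_Suc[of "2 * k + 1"] fact_Suc[of k] u
      F_def[symmetric] P_def[symmetric] Q_def[symmetric] u_def[symmetric]
    by (simp add: mult_ac)
  finally show ?case .
next
  case (3 k l)
  define F :: real where "F = fact (2 * k + l + 2)"
  define P :: real where "P = fact k"
  define Q :: real where "Q = fact (k + l + 2)"
  define u where "u = real (Suc k)"
  define v where "v = real (Suc (k + l + 2))"
  define w where "w = real (Suc (2 * k + l + 2))"
  have uv: "u > 0" "v > 0" by (simp_all add: u_def v_def)
  \<comment> \<open>Over the common denominator the recurrence reduces to this polynomial
    identity.\<close>
  have num: "real (l + 2 + 1) * u + real (l + 1) * v = real (Suc l + 1) * w"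
    by (simp add: u_def v_def w_def algebra_simps)
  have e: "2 * Suc k + Suc l = Suc (2 * k + l + 2)" "Suc k + Suc l + 1 = Suc (k + l + 2)"
    "k + (l + 2) + 1 = Suc (k + l + 2)" "2 * k + (l + 2) = 2 * k + l + 2"
    "Suc k + l + 1 = k + l + 2" "2 * Suc k + l = 2 * k + l + 2"
    by simp_all
  have facts: "fact (Suc (2 * k + l + 2)) = w * F" "fact (Suc k) = u * P"
    "fact (Suc (k + l + 2)) = v * Q"
    by (simp_all only: fact_Suc F_def P_def Q_def u_def v_def w_def of_nat_fact)
  have "real (ballot_num (Suc k) (Suc l)) =
     real (l + 2 + 1) * F / (P * (v * Q)) + real (l + 1) * F / (u * P * Q)"
    unfolding ballot_num.simps of_nat_add[of "ballot_num _ _"] 3 e facts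
    by (simp only: F_def P_def Q_def)
  also have "\<dots> = real (l + 2 + 1) * u * F / (u * P * (v * Q)) + real (l + 1) * v * F / (u * P * (v * Q))"
    using uv by simp
  also have "\<dots> = (real (l + 2 + 1) * u + real (l + 1) * v) * F / (u * P * (v * Q))"
    by (simp only: add_divide_distrib distrib_right)
  also have "\<dots> = real (Suc l + 1) * fact (2 * Suc k + Suc l) / (fact (Suc k) * fact (Suc k + Suc l + 1))"
    unfolding e facts num by (simp only: mult.assoc)
  finally show ?case .
qed

lemma ballot_num_eq_ballot: "real (ballot_num k l) = ballot (k + l + 1) (k + 1)"
proof -
  define F :: real where "F = fact (2 * k + l)"
  define P :: real where "P = fact k"
  define Q :: real where "Q = fact (k + l + 1)"
  define m where "m = real (Suc (2 * k + l))"
  have "m > 0" by (simp add: m_def)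
  have e: "k + l + 1 + (k + 1) - 1 = Suc (2 * k + l)" by simp
  have "real (Suc (2 * k + l) choose (k + l + 1)) =
      fact (Suc (2 * k + l)) / (fact (k + l + 1) * fact (Suc (2 * k + l) - (k + l + 1)))"
    by (rule binomial_fact) simp
  also have "Suc (2 * k + l) - (k + l + 1) = k" by simp
  also have "fact (Suc (2 * k + l)) = m * F" by (simp only: fact_Suc F_def m_def)
  finally have "ballot (k + l + 1) (k + 1) = real (l + 1) / m * (m * F / (Q * P))"
    unfolding ballot_def e by (simp add: m_def P_def Q_def del: fact_Suc)
  also have "\<dots> = real (l + 1) * F / (P * Q)"
    using \<open>m > 0\<close> by (simp add: mult.commute)
  finally show ?thesis
    unfolding ballot_num_eq_fact F_def P_def Q_def by simp
qed

section \<open>Avoiding 123 under prepending and concatenation\<close>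

text \<open>Otherwise the simplifier turns the pattern into \<open>[Suc 0, 2, 3]\<close>.\<close>

declare One_nat_def [simp del]

lemma avoids_123_iff:
  "avoids w [1, 2, 3] \<longleftrightarrow>
     (\<forall>i j k. i < j \<and> j < k \<and> k < length w \<longrightarrow> \<not> (w ! i < w ! j \<and> w ! j < w ! k))"
proof -
  have "contains_pattern w [1, 2, 3] \<longleftrightarrow>
     (\<exists>i j k. i < j \<and> j < k \<and> k < length w \<and> w ! i < w ! j \<and> w ! j < w ! k)" (is "?L \<longleftrightarrow> ?R")
  proof
    assume ?L
    then obtain f :: "nat \<Rightarrow> nat" where f: "strict_mono_on {..<3} f" "\<forall>a<3. f a < length w"
      "\<And>a b. a < b \<Longrightarrow> b < 3 \<Longrightarrow> (w ! f a < w ! f b \<longleftrightarrow> [1, 2, 3::nat] ! a < [1, 2, 3] ! b)"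
      unfolding contains_pattern_def by (auto simp: numeral_3_eq_3)
    have "f 0 < f 1" "f 1 < f 2"
      using f(1) by (auto simp: strict_mono_on_def)
    moreover have "f 2 < length w" using f(2) by simp
    moreover have "w ! f 0 < w ! f 1" "w ! f 1 < w ! f 2"
      using f(3)[of 0 1] f(3)[of 1 2] by simp_all
    ultimately show ?R by blast
  next
    assume ?R
    then obtain i j k where ijk: "i < j" "j < k" "k < length w" "w ! i < w ! j" "w ! j < w ! k"
      by blast
    have lt: "a < 3 \<longleftrightarrow> a = 0 \<or> a = 1 \<or> a = 2" "a < 2 \<longleftrightarrow> a = 0 \<or> a = 1" for a :: nat
      by auto
    show ?L
      unfolding contains_pattern_def
      using ijk
      by (intro exI[of _ "\<lambda>a. [i, j, k] ! a"]) (auto simp: strict_mono_on_def lt numeral_3_eq_3[symmetric])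
  qed
  then show ?thesis unfolding avoids_def by blast
qed

lemma avoids_123_Nil: "avoids [] [1, 2, 3]"
  by (simp add: avoids_123_iff)

text \<open>A new occurrence must use \<open>x\<close> as its smallest entry. The condition is a
  pairwise relation on \<open>w\<close>, so that \<open>sorted_wrt_append\<close> and monotonicity
  of \<open>sorted_wrt\<close> apply later.\<close>

lemma avoids_123_Cons:
  "avoids (x # w) [1, 2, 3] \<longleftrightarrow>
     avoids w [1, 2, 3] \<and> sorted_wrt (\<lambda>y z. \<not> (x < y \<and> y < z)) w" (is "?L \<longleftrightarrow> ?R")
proof
  assume L: ?L
  have "\<not> (w ! i < w ! j \<and> w ! j < w ! k)" if "i < j" "j < k" "k < length w" for i j k
    using L[unfolded avoids_123_iff, rule_format, of "Suc i" "Suc j" "Suc k"] that by simp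
  moreover have "\<not> (x < w ! j \<and> w ! j < w ! k)" if "j < k" "k < length w" for j k
    using L[unfolded avoids_123_iff, rule_format, of 0 "Suc j" "Suc k"] that by simp
  ultimately show ?R
    by (auto simp: avoids_123_iff sorted_wrt_iff_nth_less)
next
  assume R: ?R
  show ?L unfolding avoids_123_iff
  proof (intro allI impI)
    fix i j k assume ijk: "i < j \<and> j < k \<and> k < length (x # w)"
    then obtain j' k' where [simp]: "j = Suc j'" "k = Suc k'"
      by (metis Nat.lessE)
    show "\<not> ((x # w) ! i < (x # w) ! j \<and> (x # w) ! j < (x # w) ! k)"
      using R ijk unfolding avoids_123_iff sorted_wrt_iff_nth_less by (cases i) auto
  qed
qed

lemma avoids_123_append:
  "avoids (c @ w) [1, 2, 3] \<longleftrightarrow>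
     avoids c [1, 2, 3] \<and> avoids w [1, 2, 3] \<and>
     (\<forall>x\<in>set c. sorted_wrt (\<lambda>y z. \<not> (x < y \<and> y < z)) w) \<and>
     sorted_wrt (\<lambda>x y. \<not> (x < y \<and> (\<exists>z\<in>set w. y < z))) c"
proof (induction c)
  case Nil
  then show ?case by (simp add: avoids_123_Nil)
next
  case (Cons x c)
  show ?case
    unfolding append_Cons avoids_123_Cons[of x] Cons sorted_wrt_append by auto
qed

text \<open>A smaller \<open>x\<close> forbids more ascents in \<open>w\<close>, so the condition
  for the minimum implies those for all other entries of \<open>c\<close>.\<close>

lemma avoids_123_append_Min:
  assumes "c \<noteq> []" "avoids c [1, 2, 3]"
    and "sorted_wrt (\<lambda>x y. \<not> (x < y \<and> (\<exists>z\<in>set w. y < z))) c"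
  shows "avoids (c @ w) [1, 2, 3] \<longleftrightarrow> avoids (Min (set c) # w) [1, 2, 3]"
proof -
  have "(\<forall>x\<in>set c. sorted_wrt (\<lambda>y z. \<not> (x < y \<and> y < z)) w) \<longleftrightarrow>
        sorted_wrt (\<lambda>y z. \<not> (Min (set c) < y \<and> y < z)) w" (is "?L \<longleftrightarrow> ?R")
  proof
    assume ?L
    then show ?R using assms(1) by (simp add: Min_in)
  next
    assume R: ?R
    show ?L
    proof
      fix x assume "x \<in> set c"
      then have "Min (set c) \<le> x" by simp
      then show "sorted_wrt (\<lambda>y z. \<not> (x < y \<and> y < z)) w"
        by (intro sorted_wrt_mono_rel[OF _ R]) auto
    qed
  qed
  then show ?thesis
    using assms by (simp add: avoids_123_append avoids_123_Cons)
qed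

section \<open>Counting the continuations of a prefix\<close>

text \<open>Here \<open>r\<close> stands for the whole prefix. Allowing any set \<open>A\<close>
  lets the recursion delete entries without renumbering.\<close>

definition continuations :: "'a::linorder set \<Rightarrow> 'a \<Rightarrow> 'a list set" where
  "continuations A r = {w \<in> permutations_of_set A. avoids (r # w) [1, 2, 3]}"

lemma finite_continuations: "finite (continuations A r)"
  by (simp add: continuations_def)

lemma continuations_empty: "continuations {} r = {[]}"
  by (auto simp: continuations_def avoids_123_Cons avoids_123_Nil)

lemma Cons_mem_permutations_of_set_iff:
  "x # w \<in> permutations_of_set A \<longleftrightarrow> x \<in> A \<and> w \<in> permutations_of_set (A - {x})"
  by (auto simp: permutations_of_set_def)

text \<open>If \<open>x < r\<close>, the restriction from \<open>x\<close> subsumes that from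
  \<open>r\<close>. If \<open>r < x\<close>, a later entry above \<open>x\<close> would complete 123
  with \<open>r\<close> and \<open>x\<close>, so \<open>x\<close> is the maximum and restricts
  nothing itself.\<close>

lemma Cons_mem_continuations_iff:
  assumes "finite A" "r \<notin> A"
  shows "x # w \<in> continuations A r \<longleftrightarrow>
    x \<in> A \<and> (x < r \<and> w \<in> continuations (A - {x}) x \<or>
             r < x \<and> x = Max A \<and> w \<in> continuations (A - {x}) r)"
proof (cases "x \<in> A \<and> w \<in> permutations_of_set (A - {x})")
  case False
  then show ?thesis
    by (auto simp: continuations_def Cons_mem_permutations_of_set_iff)
next
  case True
  then have setw: "set w = A - {x}" and "x \<noteq> r"
    using assms by (auto simp: permutations_of_set_def)
  show ?thesis
  proof (cases "x < r")
    case x: True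
    have "sorted_wrt (\<lambda>y z. \<not> (r < y \<and> y < z)) w" if "sorted_wrt (\<lambda>y z. \<not> (x < y \<and> y < z)) w"
      by (rule sorted_wrt_mono_rel[OF _ that]) (use x in auto)
    then show ?thesis
      using True x by (auto simp: continuations_def Cons_mem_permutations_of_set_iff avoids_123_Cons)
  next
    case False
    then have x: "r < x" using \<open>x \<noteq> r\<close> by simp
    have max: "(\<forall>y\<in>set w. \<not> x < y) \<longleftrightarrow> x = Max A"
      using True assms by (auto simp: setw not_less intro!: Max_eqI[symmetric])
    have "sorted_wrt (\<lambda>y z. \<not> (x < y \<and> y < z)) w" if "\<forall>y\<in>set w. \<not> x < y"
      by (rule sorted_wrt_mono_rel[where P = "\<lambda>_ _. True"]) (use that in \<open>auto simp: sorted_wrt_iff_nth_less\<close>)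
    then show ?thesis
      using True x max
      by (auto simp: continuations_def Cons_mem_permutations_of_set_iff avoids_123_Cons)
  qed
qed

text \<open>Ranks in \<open>B\<close> run through \<open>0, ..., card B - 1\<close>: adding a new
  maximum leaves the old ranks unchanged and contributes the rank \<open>card B\<close>.\<close>

lemma sum_card_below:
  fixes B :: "'a::linorder set"
  assumes "finite B"
  shows "(\<Sum>x\<in>B. f (card {y\<in>B. y < x})) = (\<Sum>i<card B. f i)"
  using assms
proof (induction B rule: finite_linorder_max_induct)
  case empty
  then show ?case by simp
next
  case (insert b B)
  have "b \<notin> B" using insert.hyps by blast
  moreover have "{y \<in> insert b B. y < b} = B" using insert.hyps by auto
  moreover have "{y \<in> insert b B. y < x} = {y \<in> B. y < x}" if "x \<in> B" for x
    using insert.hyps that by auto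
  ultimately show ?case
    using insert by (simp add: add.commute)
qed

lemma card_continuations:
  assumes "finite A" "r \<notin> A"
  shows "card (continuations A r) = ballot_num (card {x\<in>A. x < r}) (card {x\<in>A. r < x})"
  using assms
proof (induction "card A" arbitrary: A r rule: less_induct)
  case less
  define B where "B = {x\<in>A. x < r}"
  define C where "C = {x\<in>A. r < x}"
  note fin = \<open>finite A\<close>
  note smaller = card_Diff1_less[OF fin]
  have "x < r \<or> r < x" if "x \<in> A" for x
    using that less.prems by (metis linorder_less_linear)
  then have AB: "A = B \<union> C" "B \<inter> C = {}" "finite B" "finite C"
    using fin by (auto simp: B_def C_def)
  then have cardA: "card A = card B + card C" by (metis card_Un_disjoint)
  show ?case
  proof (cases "A = {}")
    case True
    then show ?thesis by (simp add: continuations_empty)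
  next
    case False
    \<comment> \<open>\<open>X\<close> and \<open>Y\<close> split the continuations by first entry,
      below \<open>r\<close> or equal to the maximum. The maximum exceeds \<open>r\<close> exactly
      when \<open>C\<close> is nonempty.\<close>
    define X where "X = (\<Union>x\<in>B. (#) x ` continuations (A - {x}) x)"
    define Y where "Y = (if C = {} then {} else (#) (Max A) ` continuations (A - {Max A}) r)"
    have maxC: "C \<noteq> {} \<longleftrightarrow> r < Max A" "Max A \<in> A"
      using False fin by (auto simp: C_def Max_gr_iff)
    have "w \<in> continuations A r \<longleftrightarrow> w \<in> X \<union> Y" for w
    proof (cases w)
      case Nil
      then show ?thesis using False
        by (auto simp: continuations_def X_def Y_def permutations_of_set_def)
    next
      case (Cons x w')
      show ?thesis
        unfolding Cons Cons_mem_continuations_iff[OF less.prems] X_def Y_def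
        using maxC by (auto simp: B_def)
    qed
    then have "continuations A r = X \<union> Y" by blast
    moreover have "X \<inter> Y = {}"
      using maxC by (auto simp: X_def Y_def B_def)
    moreover have "finite X" "finite Y"
      using AB by (auto simp: X_def Y_def finite_continuations)
    ultimately have card: "card (continuations A r) = card X + card Y"
      by (simp add: card_Un_disjoint)
    \<comment> \<open>Once \<open>x\<close> replaces \<open>r\<close>, all remaining entries that
      are not below \<open>x\<close>, including those of \<open>C\<close>, count as above.\<close>
    have step: "card (continuations (A - {x}) x) =
        ballot_num (card {y\<in>B. y < x}) (card B + card C - 1 - card {y\<in>B. y < x})"
      if x: "x \<in> B" for x
    proof -
      have xA: "x \<in> A" "x < r" using x by (auto simp: B_def)
      let ?L = "{y \<in> A - {x}. y < x}" and ?G = "{y \<in> A - {x}. x < y}"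
      have L: "?L = {y\<in>B. y < x}" using xA by (auto simp: B_def)
      have "A - {x} = ?L \<union> ?G" by auto
      moreover have "card (?L \<union> ?G) = card ?L + card ?G"
        by (rule card_Un_disjoint) (use fin in auto)
      ultimately have "card (A - {x}) = card ?L + card ?G" by (simp only:)
      moreover have "card (A - {x}) = card A - 1" using xA by simp
      ultimately have "card ?G = card B + card C - 1 - card ?L" using cardA by simp
      moreover have "card (continuations (A - {x}) x) = ballot_num (card ?L) (card ?G)"
        by (rule less.hyps[OF smaller]) (use xA fin in auto)
      ultimately show ?thesis by (simp only: L)
    qed
    have "card X = (\<Sum>x\<in>B. card ((#) x ` continuations (A - {x}) x))"
      unfolding X_def
      by (rule card_UN_disjoint) (use AB in \<open>auto simp: finite_continuations\<close>)
    also have "\<dots> = (\<Sum>x\<in>B. ballot_num (card {y\<in>B. y < x})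
                         (card B + card C - 1 - card {y\<in>B. y < x}))"
      by (intro sum.cong) (simp_all add: card_image step)
    also have "\<dots> = (\<Sum>i<card B. ballot_num i (card B + card C - 1 - i))"
      by (rule sum_card_below) (rule AB)
    finally have X: "card X = (\<Sum>i<card B. ballot_num i (card B + card C - 1 - i))" .
    have Y: "card Y = (if card C = 0 then 0 else ballot_num (card B) (card C - 1))"
    proof (cases "C = {}")
      case True
      then show ?thesis by (simp add: Y_def)
    next
      case False
      then have r: "r < Max A" "Max A \<in> A" using maxC by auto
      have "card (continuations (A - {Max A}) r) =
        ballot_num (card {x\<in>A - {Max A}. x < r}) (card {x\<in>A - {Max A}. r < x})"
        by (rule less.hyps[OF smaller]) (use r less.prems in auto)
      also have "{x\<in>A - {Max A}. x < r} = B" using r by (auto simp: B_def)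
      also have "{x\<in>A - {Max A}. r < x} = C - {Max A}" by (auto simp: C_def)
      also have "card (C - {Max A}) = card C - 1" using r by (simp add: C_def)
      finally show ?thesis
        using False AB by (simp add: Y_def card_image)
    qed
    have "0 < card B + card C" using False fin cardA by (metis card_gt_0_iff)
    then show ?thesis
      unfolding card X Y B_def[symmetric] C_def[symmetric] by (rule ballot_num_rec[symmetric])
  qed
qed

section \<open>From continuations to permutations with a prescribed prefix\<close>

lemma perms_prefix_avoiding_eq:
  assumes "set c \<subseteq> {1..n}" "distinct c"
  shows "perms_prefix_avoiding n c \<sigma> =
    (@) c ` {w \<in> permutations_of_set ({1..n} - set c). avoids (c @ w) \<sigma>}"
proof -
  have "\<tau> \<in> perms_prefix_avoiding n c \<sigma> \<longleftrightarrow>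
    (\<exists>w. \<tau> = c @ w \<and> w \<in> permutations_of_set ({1..n} - set c) \<and> avoids (c @ w) \<sigma>)" for \<tau>
  proof -
    have "take (length c) \<tau> = c \<longleftrightarrow> (\<exists>w. \<tau> = c @ w)"
      by (metis append_eq_conv_conj append_take_drop_id)
    moreover have "c @ w \<in> permutations_of_set {1..n} \<longleftrightarrow> w \<in> permutations_of_set ({1..n} - set c)" for w
      using assms by (auto simp: permutations_of_set_def)
    ultimately show ?thesis
      by (auto simp: perms_prefix_avoiding_def perms_def)
  qed
  then show ?thesis by blast
qed

text \<open>With r the minimum of \<open>c\<close>, all r - 1 smaller numbers are missing, and
  \<open>c\<close> occupies \<open>length c\<close> of the n - r + 1 numbers from r on. The second
  conclusion makes r an admissible first entry for length \<open>n - length c + 1\<close>.\<close>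

lemma card_perms_prefix_avoiding_123:
  assumes c: "set c \<subseteq> {1..n}" "distinct c" "c \<noteq> []" "avoids c [1, 2, 3]"
    and asc: "sorted_wrt (\<lambda>x y. \<not> (x < y \<and> (\<exists>\<alpha>\<in>{1..n} - set c. y < \<alpha>))) c"
  shows "card (perms_prefix_avoiding n c [1, 2, 3]) =
    ballot_num (Min (set c) - 1) (n - length c + 1 - Min (set c))"
    and "Min (set c) \<in> {1..n - length c + 1}"
proof -
  let ?r = "Min (set c)" and ?A = "{1..n} - set c"
  have r: "?r \<in> set c" "\<And>x. x \<in> set c \<Longrightarrow> ?r \<le> x" using c(3) by auto
  \<comment> \<open>Since \<open>c\<close> fits into the interval from its minimum to
    \<open>n\<close>, the later natural-number subtractions are exact.\<close>
  have "card (set c) \<le> card {?r..n}"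
    by (rule card_mono) (use c(1) r in auto)
  then have "length c \<le> n + 1 - ?r"
    using c(2) by (simp add: distinct_card)
  moreover have "?r \<in> {1..n}" using r(1) c(1) by blast
  moreover have "0 < length c" using c(3) by simp
  ultimately have le: "length c \<le> n" "?r \<le> n - length c + 1"
    unfolding atLeastAtMost_iff by linarith+
  have "avoids (c @ w) [1, 2, 3] \<longleftrightarrow> avoids (?r # w) [1, 2, 3]" if "w \<in> permutations_of_set ?A" for w
    by (rule avoids_123_append_Min) (use that c asc in \<open>auto simp: permutations_of_set_def\<close>)
  then have "perms_prefix_avoiding n c [1, 2, 3] = (@) c ` continuations ?A ?r"
    unfolding perms_prefix_avoiding_eq[OF c(1,2)] continuations_def by (auto simp del: Min_in)
  then have "card (perms_prefix_avoiding n c [1, 2, 3]) = card (continuations ?A ?r)"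
    by (simp add: card_image inj_on_def)
  also have "\<dots> = ballot_num (card {x\<in>?A. x < ?r}) (card {x\<in>?A. ?r < x})"
    by (rule card_continuations) (use r in auto)
  also have "{x\<in>?A. x < ?r} = {1..<?r}"
    using c(1) r by (fastforce simp: not_less[symmetric])
  also have "{x\<in>?A. ?r < x} = {?r..n} - set c"
    using c(1) r by (fastforce simp: less_le)
  also have "card ({?r..n} - set c) = n + 1 - ?r - length c"
    using c(1,2) r(2) by (subst card_Diff_subset) (auto simp: distinct_card)
  also have "n + 1 - ?r - length c = n - length c + 1 - ?r"
    using le by linarith
  finally show "card (perms_prefix_avoiding n c [1, 2, 3]) =
    ballot_num (?r - 1) (n - length c + 1 - ?r)"
    by simp
  show "?r \<in> {1..n - length c + 1}"
    using c(1) r(1) le by auto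
qed

lemma perms_first_avoiding_eq_prefix:
  assumes "0 < m"
  shows "perms_first_avoiding m r \<sigma> = perms_prefix_avoiding m [r] \<sigma>"
proof -
  have "take (length [r]) \<tau> = [r] \<longleftrightarrow> \<tau> ! 0 = r" if "\<tau> \<in> perms m" for \<tau>
    using assms that by (cases \<tau>) (auto simp: perms_def permutations_of_set_def)
  then show ?thesis
    unfolding perms_first_avoiding_def perms_prefix_avoiding_def by blast
qed

text \<open>A prefix of length one has no ascent and is its own minimum, so the prefix count
  applies.\<close>

lemma card_perms_first_avoiding_123:
  assumes "r \<in> {1..m}"
  shows "card (perms_first_avoiding m r [1, 2, 3]) = ballot_num (r - 1) (m - r)"
proof -
  have "avoids [r] [1, 2, 3]" by (simp add: avoids_123_iff)
  then show ?thesis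
    using assms card_perms_prefix_avoiding_123(1)[of "[r]" m]
    by (simp add: perms_first_avoiding_eq_prefix)
qed

theorem theorem4p4:
  fixes n t :: nat and c :: "nat list"
  assumes "n \<ge> 3" and "1 \<le> t" and "t < n"
    and "length c = t" and "set c \<subseteq> {1..n}" and "distinct c"
    and "avoids c [1, 2, 3]"
  shows "if \<exists>i j. i < j \<and> j < t \<and> c ! i < c ! j \<and> (\<exists>\<alpha>\<in>{1..n}. \<alpha> > c ! j \<and> \<alpha> \<notin> set c)
         then card (perms_prefix_avoiding n c [1, 2, 3]) = 0
         else card (perms_prefix_avoiding n c [1, 2, 3])
                = card (perms_first_avoiding (n - t + 1) (Min (set c)) [1, 2, 3]) \<and>
              real (card (perms_first_avoiding (n - t + 1) (Min (set c)) [1, 2, 3]))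
                = ballot (n - t + 1) (Min (set c))"
proof -
  let ?asc = "sorted_wrt (\<lambda>x y. \<not> (x < y \<and> (\<exists>\<alpha>\<in>{1..n} - set c. y < \<alpha>))) c"
  have cond: "(\<exists>i j. i < j \<and> j < t \<and> c ! i < c ! j \<and> (\<exists>\<alpha>\<in>{1..n}. \<alpha> > c ! j \<and> \<alpha> \<notin> set c)) \<longleftrightarrow> \<not> ?asc"
    using assms(4) unfolding sorted_wrt_iff_nth_less by blast
  show ?thesis
  proof (cases ?asc)
    case False
    \<comment> \<open>The number \<alpha> above an ascent of \<open>c\<close> is missing from
      \<open>c\<close>, so it occurs in every \<open>w\<close> and completes 123.\<close>
    have "\<not> avoids (c @ w) [1, 2, 3]" if "w \<in> permutations_of_set ({1..n} - set c)" for w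
      using False permutations_of_setD(1)[OF that] by (simp add: avoids_123_append)
    then have "perms_prefix_avoiding n c [1, 2, 3] = {}"
      by (auto simp: perms_prefix_avoiding_eq assms)
    then show ?thesis using False cond by simp
  next
    case True
    have "c \<noteq> []" using assms by auto
    note prefix = card_perms_prefix_avoiding_123[OF assms(5,6) this assms(7) True]
    note first = card_perms_first_avoiding_123[OF prefix(2)]
    \<comment> \<open>The bounds on the minimum rule out truncated subtraction, so the arguments of
      \<open>ballot_num_eq_ballot\<close> become \<open>n - t + 1\<close> and
      \<open>Min (set c)\<close>.\<close>
    have "Min (set c) - 1 + (n - t + 1 - Min (set c)) + 1 = n - t + 1" "Min (set c) - 1 + 1 = Min (set c)"
      using prefix(2) assms(4) by auto
    then have "real (ballot_num (Min (set c) - 1) (n - t + 1 - Min (set c))) = ballot (n - t + 1) (Min (set c))"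
      using ballot_num_eq_ballot[of "Min (set c) - 1" "n - t + 1 - Min (set c)"] by (simp only:)
    then show ?thesis
      unfolding cond using True prefix(1) first assms(4) by (simp only: not_True_eq_False if_False simp_thms)
  qed
qed

end
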